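(* Let $\tau$ be in the upper half-plane and let $\xi\in\mathbb{C}$ satisfy $|\Im(\xi/\tau)|<-\Im(1/\tau)$. Then $$P_-(\tau,\xi)-P_+(\tau,\xi)=2i\sum_{n=1}^\infty\frac{\sin\frac{2n\xi\pi}{\tau}}{n\,(e^{2n\pi i/\tau}-1)}.$$
   Context: For $d\in(-\pi,0)\cup(0,\pi)$ define $$P^d(\tau,\xi)=\int_0^{\infty e^{id}}\frac{\sin\bigl(\frac{\xi}{\tau}t\bigr)}{e^{it/\tau}-1}\Bigl(\cot\frac t2-\frac2t\Bigr)\frac{dt}{t},$$ the integral being along the half-line from $0$ with argument $d$; $P^d$ is analytic on $\Omega^d=\bigcup_{\sigma\in(0,\pi)}\bigl(0,\infty e^{i(d+\sigma)}\bigr)\times\{\xi\in\mathbb{C}:|\Im(\xi e^{-i\sigma})|<\sin\sigma\}$ (here $(0,\infty e^{i\theta})$ is the open ray of argument $\theta$ and $\tau$ ranges over the Riemann surface of the logarithm). $P_-$ denotes the analytic function on $\Omega_-=\{\arg\tau\in(-\pi,\pi)\}\times\bigl(\mathbb{C}\setminus((-\infty,-1]\cup[1,\infty))\bigr)$ that agrees with $P^d$ on $\Omega^d$ for every $d\in(-\pi,0)$, and $P_+$ denotes the analytic function on $\Omega_+=\{\arg\tau\in(0,2\pi)\}\times\bigl(\mathbb{C}\setminus((-\infty,-1]\cup[1,\infty))\bigr)$ that agrees with $P^d$ on $\Omega^d$ for every $d\in(0,\pi)$. *)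

theory Defs
  imports "HOL-Analysis.Analysis"
begin

definition ray_integral :: "real \<Rightarrow> (complex \<Rightarrow> complex) \<Rightarrow> complex" where
  "ray_integral d f = integral {0..} (\<lambda>r::real. f (of_real r * cis d) * cis d)"

definition P_ray :: "real \<Rightarrow> complex \<Rightarrow> complex \<Rightarrow> complex" where
  "P_ray d \<tau> \<xi> = ray_integral d
     (\<lambda>t. sin (\<xi> / \<tau> * t) / (exp (\<i> * t / \<tau>) - 1) * (cot (t / 2) - 2 / t) / t)"

text \<open>
  The variable \<open>\<tau>\<close> lives on the Riemann surface of the logarithm. For \<open>-\<pi> < d < 0\<close> all
  arguments \<open>d + \<sigma>\<close> lie in \<open>(-\<pi>, \<pi>)\<close>, and for \<open>0 < d < \<pi>\<close> they lie in \<open>(0, 2\<pi>)\<close>. Each of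
  these sectors projects injectively to the complex plane, and \<open>P_ray\<close> depends only on the
  projection, so within each of the two families \<open>\<tau>\<close> is represented by its projection. Points
  with argument in \<open>(0, \<pi>)\<close> belong to both sectors and project to the upper half-plane.
\<close>

definition Omega :: "real \<Rightarrow> (complex \<times> complex) set" where
  "Omega d = {(of_real r * cis (d + \<sigma>), \<xi>) | r \<sigma> \<xi>.
     0 < r \<and> 0 < \<sigma> \<and> \<sigma> < pi \<and> \<bar>Im (\<xi> * cis (- \<sigma>))\<bar> < sin \<sigma>}"

definition cut_plane :: "complex set" where
  "cut_plane = - complex_of_real ` ({..-1} \<union> {1..})"

definition Omega_minus :: "(complex \<times> complex) set" where
  "Omega_minus = {of_real r * cis \<theta> | r \<theta>. 0 < r \<and> - pi < \<theta> \<and> \<theta> < pi} \<times> cut_plane"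

definition Omega_plus :: "(complex \<times> complex) set" where
  "Omega_plus = {of_real r * cis \<theta> | r \<theta>. 0 < r \<and> 0 < \<theta> \<and> \<theta> < 2 * pi} \<times> cut_plane"

text \<open>Joint complex differentiability; on an open set this is analyticity in two variables.\<close>

definition analytic2_on :: "(complex \<times> complex \<Rightarrow> complex) \<Rightarrow> (complex \<times> complex) set \<Rightarrow> bool" where
  "analytic2_on F S \<longleftrightarrow> (\<forall>z\<in>S. \<exists>a b. (F has_derivative (\<lambda>(h, k). a * h + b * k)) (at z))"

text \<open>
  Analyticity is required on the union of the sets \<open>Omega d\<close>. On the larger set
  \<open>Omega_minus\<close> (resp. \<open>Omega_plus\<close>) it would be unsatisfiable: for fixed non-real \<open>\<tau>\<close> the
  \<open>\<xi>\<close>-derivative of the glued function is unbounded near \<open>\<xi> = 1 + \<tau>\<close> (resp. \<open>\<xi> = 1 - \<tau>\<close>),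
  as one sees by expanding \<open>1 / (exp (\<i> * t / \<tau>) - 1)\<close> and \<open>cot (t / 2)\<close> in exponentials, and this
  point lies in \<open>cut_plane\<close>. By \<open>is_P_minusI\<close> and \<open>is_P_plusI\<close> below the present condition is
  implied by the one with the larger domain, so results assuming it are the stronger ones.
\<close>

definition is_P_minus :: "(complex \<times> complex \<Rightarrow> complex) \<Rightarrow> bool" where
  "is_P_minus F \<longleftrightarrow> analytic2_on F (\<Union>d\<in>{- pi<..<0}. Omega d) \<and>
     (\<forall>d\<in>{- pi<..<0}. \<forall>(\<tau>, \<xi>)\<in>Omega d. F (\<tau>, \<xi>) = P_ray d \<tau> \<xi>)"

definition is_P_plus :: "(complex \<times> complex \<Rightarrow> complex) \<Rightarrow> bool" where
  "is_P_plus F \<longleftrightarrow> analytic2_on F (\<Union>d\<in>{0<..<pi}. Omega d) \<and>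
     (\<forall>d\<in>{0<..<pi}. \<forall>(\<tau>, \<xi>)\<in>Omega d. F (\<tau>, \<xi>) = P_ray d \<tau> \<xi>)"

lemma strip_subset_cut_plane:
  assumes "0 < \<sigma>" "\<sigma> < pi" "\<bar>Im (\<xi> * cis (- \<sigma>))\<bar> < sin \<sigma>"
  shows "\<xi> \<in> cut_plane"
proof (rule ccontr)
  assume "\<xi> \<notin> cut_plane"
  then obtain x where x: "\<xi> = of_real x" "\<bar>x\<bar> \<ge> 1"
    by (auto simp: cut_plane_def)
  have s: "sin \<sigma> > 0"
    using assms by (simp add: sin_gt_zero)
  have "\<bar>Im (\<xi> * cis (- \<sigma>))\<bar> = \<bar>x\<bar> * sin \<sigma>"
    using s by (simp add: x abs_mult)
  moreover have "1 * sin \<sigma> \<le> \<bar>x\<bar> * sin \<sigma>"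
    using s x by (intro mult_right_mono) auto
  ultimately show False
    using assms by simp
qed

lemma Omega_subset_Omega_minus:
  assumes "d \<in> {- pi<..<0}"
  shows "Omega d \<subseteq> Omega_minus"
proof
  fix z assume "z \<in> Omega d"
  then obtain r \<sigma> \<xi> where z: "z = (of_real r * cis (d + \<sigma>), \<xi>)" "0 < r" "0 < \<sigma>" "\<sigma> < pi"
    "\<bar>Im (\<xi> * cis (- \<sigma>))\<bar> < sin \<sigma>"
    unfolding Omega_def by blast
  have "- pi < d + \<sigma>" "d + \<sigma> < pi"
    using assms z by auto
  then show "z \<in> Omega_minus"
    unfolding Omega_minus_def using z strip_subset_cut_plane by blast
qed

lemma Omega_subset_Omega_plus:
  assumes "d \<in> {0<..<pi}"
  shows "Omega d \<subseteq> Omega_plus"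
proof
  fix z assume "z \<in> Omega d"
  then obtain r \<sigma> \<xi> where z: "z = (of_real r * cis (d + \<sigma>), \<xi>)" "0 < r" "0 < \<sigma>" "\<sigma> < pi"
    "\<bar>Im (\<xi> * cis (- \<sigma>))\<bar> < sin \<sigma>"
    unfolding Omega_def by blast
  have "0 < d + \<sigma>" "d + \<sigma> < 2 * pi"
    using assms z by auto
  then show "z \<in> Omega_plus"
    unfolding Omega_plus_def using z strip_subset_cut_plane by blast
qed

lemma is_P_minusI:
  assumes "analytic2_on F Omega_minus"
    and "\<And>d \<tau> \<xi>. d \<in> {- pi<..<0} \<Longrightarrow> (\<tau>, \<xi>) \<in> Omega d \<Longrightarrow> F (\<tau>, \<xi>) = P_ray d \<tau> \<xi>"
  shows "is_P_minus F"
  using assms Omega_subset_Omega_minus unfolding is_P_minus_def analytic2_on_def by blast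

lemma is_P_plusI:
  assumes "analytic2_on F Omega_plus"
    and "\<And>d \<tau> \<xi>. d \<in> {0<..<pi} \<Longrightarrow> (\<tau>, \<xi>) \<in> Omega d \<Longrightarrow> F (\<tau>, \<xi>) = P_ray d \<tau> \<xi>"
  shows "is_P_plus F"
  using assms Omega_subset_Omega_plus unfolding is_P_plus_def analytic2_on_def by blast

end

theory Submission
  imports Defs "HOL-Complex_Analysis.Complex_Analysis"
begin

text \<open>
  For small \<open>d > 0\<close> the point \<open>(\<tau>, \<xi>)\<close> lies in both \<open>Omega (- d)\<close> and \<open>Omega d\<close>, so the left-hand side
  is the difference of the integrals along the rays of arguments \<open>- d\<close> and \<open>d\<close>. The strip condition on
  \<open>\<xi>\<close> is precisely what makes \<open>sin (\<xi> t / \<tau>) / (exp (\<i> t / \<tau>) - 1)\<close> decay exponentially in a wedge around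
  the positive real axis. Closing the two rays by the vertical line \<open>Re t = (2 N + 1) \<pi>\<close>, on which
  \<open>cot (t / 2)\<close> is bounded by 1, the residue theorem turns the difference into the sum of the residues
  at the poles \<open>2 \<pi> n\<close> of \<open>cot (t / 2)\<close>; the singularity at the vertex 0 is removable.
\<close>

section \<open>Growth of the sine and the cotangent\<close>

lemma norm_sin_squared':
  "norm (sin z) ^ 2 = sin (Re z) ^ 2 + (exp (Im z) - inverse (exp (Im z))) ^ 2 / 4"
  using norm_cos_squared[of "of_real pi / 2 - z"]
  by (simp add: cos_diff sin_diff exp_minus power2_commute)

text \<open>With y = Im z the hypothesis gives |cos z|^2 = sinh(y)^2 and |sin z|^2 = 1 + sinh(y)^2.
  This controls the integrand on the vertical side of the triangle.\<close>

lemma norm_cot_le_1: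
  assumes "cos (Re z) = 0"
  shows "norm (cot z) \<le> 1"
proof -
  have "norm (cos z) ^ 2 \<le> norm (sin z) ^ 2"
    by (simp add: norm_cos_squared norm_sin_squared' assms)
  then have "norm (cos z) \<le> norm (sin z)"
    using power2_le_imp_le by fastforce
  then show ?thesis
    by (simp add: cot_def norm_divide divide_le_eq_1)
qed

text \<open>Off the real axis |sin z| is at least \<open>s\<close> = |sinh(Im z)| and |cos z| is at
  most 1 + \<open>s\<close>, while |sinh y| >= |y|. This serves on the slanted rays.\<close>

lemma norm_cot_le:
  assumes "Im z \<noteq> 0"
  shows "norm (cot z) \<le> 1 + 1 / \<bar>Im z\<bar>"
proof -
  define s where "s = \<bar>(exp (Im z) - inverse (exp (Im z))) / 2\<bar>"
  have s: "\<bar>Im z\<bar> \<le> s"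
    using real_le_abs_sinh[of "Im z"] by (simp add: s_def)
  then have s0: "s > 0" using assms by linarith
  have c: "norm (cos z) ^ 2 \<le> 1 + s\<^sup>2"
    by (simp add: norm_cos_squared s_def power_divide abs_square_le_1)
  have n: "s\<^sup>2 \<le> norm (sin z) ^ 2"
    by (simp add: norm_sin_squared' s_def power_divide)
  have "1 + s\<^sup>2 \<le> (1 + s)\<^sup>2"
    using s0 by (simp add: power2_eq_square algebra_simps)
  from power2_le_imp_le[OF order_trans[OF c this]] have c': "norm (cos z) \<le> 1 + s"
    using s0 by simp
  have n': "s \<le> norm (sin z)"
    using n by (rule power2_le_imp_le) simp
  have "norm (cot z) \<le> (1 + s) / s"
    unfolding cot_def norm_divide using c' n' s0 by (intro frac_le) auto
  also have "\<dots> = 1 + 1 / s" using s0 by (simp add: field_simps)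
  also have "\<dots> \<le> 1 + 1 / \<bar>Im z\<bar>"
    using s assms by (simp add: frac_le)
  finally show ?thesis .
qed

lemma norm_sin_le_exp_Im:
  fixes z :: complex
  shows "norm (sin z) \<le> exp \<bar>Im z\<bar>"
proof -
  have "norm (exp (\<i> * z) - exp (- (\<i> * z))) \<le> exp (- Im z) + exp (Im z)"
    by (rule order_trans[OF norm_triangle_ineq4]) simp
  also have "\<dots> \<le> 2 * exp \<bar>Im z\<bar>"
    by (smt (verit) exp_le_cancel_iff)
  finally show ?thesis
    by (simp add: sin_exp_eq norm_divide norm_mult)
qed

section \<open>Truncated and improper integrals along a ray\<close>

lemma contour_integral_ray:
  assumes "R > 0" "continuous_on {0..R} (\<lambda>r. f (of_real r * cis \<phi>))"
  shows "contour_integral (linepath 0 (of_real R * cis \<phi>)) f =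
         integral {0..R} (\<lambda>r. f (of_real r * cis \<phi>) * cis \<phi>)"
proof -
  let ?h = "\<lambda>r. f (of_real r * cis \<phi>) * cis \<phi>"
  have "(?h has_integral integral {0..R} ?h) {0..R}"
    using assms by (intro integrable_integral integrable_continuous_real continuous_intros)
  from has_integral_stretch_real[OF this, of R]
  have "((\<lambda>x. ?h (R * x)) has_integral (1 / R) *\<^sub>R integral {0..R} ?h) {0..1}"
    using assms by simp
  from has_integral_mult_right[OF this, of "of_real R"]
  have "((\<lambda>x. f (linepath 0 (of_real R * cis \<phi>) x) * (of_real R * cis \<phi> - 0))
          has_integral integral {0..R} ?h) {0..1}"
    using assms by (simp add: linepath_def scaleR_conv_of_real mult_ac)
  then show ?thesis
    by (intro contour_integral_unique) (simp add: has_contour_integral_linepath)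
qed

text \<open>Domination by an integrable exponential makes \<open>h\<close> absolutely integrable, so
  the gauge integral is a Lebesgue integral and hence the limit of its truncations.\<close>

lemma integral_to_infinity_tendsto:
  fixes h :: "real \<Rightarrow> complex"
  assumes "continuous_on {0..} h" "\<delta> > 0" "\<And>r. r \<ge> 0 \<Longrightarrow> norm (h r) \<le> C * exp (- \<delta> * r)"
  shows "((\<lambda>R. integral {0..R} h) \<longlongrightarrow> integral {0..} h) at_top"
proof -
  have abs: "h absolutely_integrable_on {0..}"
  proof (rule measurable_bounded_by_integrable_imp_absolutely_integrable)
    show "h \<in> borel_measurable (lebesgue_on {0..})"
      using assms(1) by (intro continuous_imp_measurable_on_sets_lebesgue) auto
    show "(\<lambda>r. C * exp (- \<delta> * r)) integrable_on {0..}"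
      using integrable_on_exp_minus_to_infinity[of \<delta> 0] assms(2)
      by (intro integrable_on_mult_right) auto
  qed (use assms(3) in auto)
  have "((\<lambda>R. LINT x:{0..R}|lebesgue. h x) \<longlongrightarrow> (LINT x:{0..}|lebesgue. h x)) at_top"
    by (rule tendsto_set_lebesgue_integral_at_top) (use abs in auto)
  moreover have "(LINT x:{0..R}|lebesgue. h x) = integral {0..R} h" for R
    by (intro set_lebesgue_integral_eq_integral set_integrable_subset[OF abs]) auto
  moreover have "(LINT x:{0..}|lebesgue. h x) = integral {0..} h"
    by (intro set_lebesgue_integral_eq_integral abs)
  ultimately show ?thesis by simp
qed

section \<open>The integrand near 0 and near the poles of the cotangent\<close>

definition P_integrand :: "complex \<Rightarrow> complex \<Rightarrow> complex \<Rightarrow> complex" where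
  "P_integrand \<tau> \<xi> t = sin (\<xi> / \<tau> * t) / (exp (\<i> * t / \<tau>) - 1) * (cot (t / 2) - 2 / t) / t"

lemma norm_mult_cos_minus_sin_le:
  fixes t :: complex
  assumes "norm t \<le> 1"
  shows "norm (t * cos (t / 2) - 2 * sin (t / 2)) \<le> norm t ^ 3"
proof -
  \<comment> \<open>The derivative of \<open>t cos (t / 2) - 2 sin (t / 2)\<close> is \<open>- (t / 2) sin (t / 2)\<close>, of second order at 0.\<close>
  have sin_le: "norm (sin z) \<le> 2 * norm z" if "norm z \<le> 1 / 2" for z :: complex
  proof -
    have "norm (cos w) \<le> 2" if "w \<in> cball 0 (1/2)" for w :: complex
    proof -
      have "exp (1 / 2 :: real) \<le> 2"
        using exp_bound_half[of "1/2 :: real"] by simp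
      moreover have "norm (cos w) \<le> exp (1/2)"
        by (rule order_trans[OF norm_cos_le]) (use that in auto)
      ultimately show ?thesis by linarith
    qed
    then have "norm (sin z - sin 0) \<le> 2 * norm (z - 0)"
      using that by (intro field_differentiable_bound[OF convex_cball[of 0 "1/2"], of sin cos])
        (auto intro: DERIV_subset[OF DERIV_sin])
    then show ?thesis by simp
  qed
  let ?q = "\<lambda>t::complex. t * cos (t / 2) - 2 * sin (t / 2)"
  have "norm (?q t - ?q 0) \<le> norm t ^ 2 * norm (t - 0)"
  proof (rule field_differentiable_bound[OF convex_cball[of 0 "norm t"]])
    fix z :: complex assume z: "z \<in> cball 0 (norm t)"
    show "(?q has_field_derivative (- (z / 2) * sin (z / 2))) (at z within cball 0 (norm t))"
      by (auto intro!: derivative_eq_intros)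
    have "norm (sin (z / 2)) \<le> 2 * norm (z / 2)"
      using z assms by (intro sin_le) auto
    then have "norm (z / 2) * norm (sin (z / 2)) \<le> norm z * norm z"
      by (intro mult_mono) (auto simp: norm_divide)
    also have "\<dots> \<le> norm t ^ 2"
      unfolding power2_eq_square using z by (intro mult_mono) auto
    finally show "norm (- (z / 2) * sin (z / 2)) \<le> norm t ^ 2"
      by (simp add: norm_mult)
  qed auto
  then show ?thesis by (simp add: power2_eq_square power3_eq_cube)
qed

text \<open>Away from 0 the integrand factors as \<open>?u t * (?q / t ^ 3) * ?v t\<close>: the
  outer factors have limits at 0, and the middle one is at most 1 in norm by the cubic bound.
  Boundedness is all that a removable singularity requires.\<close>

lemma P_integrand_bounded_at_0:
  assumes "\<tau> \<noteq> 0"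
  shows "\<exists>B. eventually (\<lambda>t. norm (P_integrand \<tau> \<xi> t) \<le> B) (at 0)"
proof -
  let ?u = "\<lambda>t. sin (\<xi> / \<tau> * t) / (exp (\<i> * t / \<tau>) - 1)" and ?v = "\<lambda>t::complex. t / sin (t / 2)"
  have 1: "(?u \<longlongrightarrow> \<xi> / \<i>) (at 0)"
    by (rule lhopital_complex_simple[where f' = "\<xi> / \<tau>" and g' = "\<i> / \<tau>"])
       (use assms in \<open>auto intro!: derivative_eq_intros simp: field_simps\<close>)
  have 2: "(?v \<longlongrightarrow> 2) (at 0)"
    by (rule lhopital_complex_simple[where f' = 1 and g' = "1 / 2"])
       (auto intro!: derivative_eq_intros)
  have "eventually (\<lambda>t. norm (?u t) < norm (\<xi> / \<i>) + 1) (at 0)"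
    using tendsto_norm[OF 1] by (rule order_tendstoD) simp
  moreover have "eventually (\<lambda>t. norm (?v t) < 3) (at 0)"
    using tendsto_norm[OF 2] by (rule order_tendstoD) simp
  moreover have "eventually (\<lambda>t::complex. t \<noteq> 0) (at 0)"
    by (simp add: eventually_at_filter)
  moreover have "eventually (\<lambda>t::complex. norm t < 1) (at 0)"
    using tendsto_norm[OF tendsto_ident_at[of "0::complex" UNIV]]
    by (rule order_tendstoD) simp
  \<comment> \<open>Since division by 0 yields 0, a nonzero quotient certifies
    \<open>sin (t / 2) \<noteq> 0\<close>.\<close>
  moreover have "eventually (\<lambda>t. ?v t \<noteq> 0) (at 0)"
    by (rule tendsto_imp_eventually_ne[OF 2]) simp
  ultimately have "eventually (\<lambda>t. norm (P_integrand \<tau> \<xi> t) \<le> (norm (\<xi> / \<i>) + 1) * 1 * 3) (at 0)"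
  proof eventually_elim
    case (elim t)
    let ?q = "t * cos (t / 2) - 2 * sin (t / 2)"
    have "sin (t / 2) \<noteq> 0" using elim by auto
    then have eq: "P_integrand \<tau> \<xi> t = ?u t * (?q / t ^ 3) * ?v t"
      using elim(3) by (simp add: P_integrand_def cot_def divide_simps power3_eq_cube)
    have "norm (?q / t ^ 3) \<le> 1"
      using norm_mult_cos_minus_sin_le[of t] elim
      by (simp add: norm_divide norm_power divide_le_eq)
    then show ?case
      unfolding eq norm_mult using elim by (intro mult_mono) auto
  qed
  then show ?thesis by blast
qed

text \<open>Multiplied by \<open>w - z\<close>, the term \<open>2 / w\<close> vanishes in the limit
  and \<open>cot (w / 2)\<close> tends to 2, because \<open>(w - z) / sin (w / 2)\<close> tends to
  \<open>2 / cos (z / 2)\<close>.\<close>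

lemma P_integrand_residue_limit:
  assumes "exp (\<i> * z / \<tau>) \<noteq> 1" "z = of_real (2 * real n * pi)" "n > 0" "\<tau> \<noteq> 0"
  shows "((\<lambda>w. P_integrand \<tau> \<xi> w * (w - z)) \<longlongrightarrow>
           2 * (sin (\<xi> / \<tau> * z) / ((exp (\<i> * z / \<tau>) - 1) * z))) (at z)"
proof -
  have z0: "z \<noteq> 0" using assms by auto
  have z2: "z / 2 = of_real (real n * pi)" using assms by simp
  have s0: "sin (z / 2) = 0" unfolding z2 sin_of_real by simp
  have c0: "cos (z / 2) \<noteq> 0" unfolding z2 cos_of_real by simp
  have L: "((\<lambda>w. (w - z) / sin (w / 2)) \<longlongrightarrow> 2 / cos (z / 2)) (at z)"
    by (rule lhopital_complex_simple[where f' = 1 and g' = "cos (z / 2) / 2"])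
       (use s0 c0 in \<open>auto intro!: derivative_eq_intros\<close>)
  have "((\<lambda>w. sin (\<xi> / \<tau> * w) / ((exp (\<i> * w / \<tau>) - 1) * w) *
       (cos (w / 2) * ((w - z) / sin (w / 2)) - 2 * (w - z) / w)) \<longlongrightarrow>
       sin (\<xi> / \<tau> * z) / ((exp (\<i> * z / \<tau>) - 1) * z) *
       (cos (z / 2) * (2 / cos (z / 2)) - 2 * (z - z) / z)) (at z)"
    using assms(1,4) z0 by (intro tendsto_intros L) auto
  moreover have "sin (\<xi> / \<tau> * w) / ((exp (\<i> * w / \<tau>) - 1) * w) *
       (cos (w / 2) * ((w - z) / sin (w / 2)) - 2 * (w - z) / w) = P_integrand \<tau> \<xi> w * (w - z)" for w
  proof -
    \<comment> \<open>This uses only ring laws and multiplicativity of \<open>inverse\<close>, so it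
      also holds where a denominator vanishes and needs no side conditions on
      \<open>w\<close>.\<close>
    have "s / (e * w) * (c * ((w - z) / n) - 2 * (w - z) / w) = s / e * (c / n - 2 / w) / w * (w - z)"
      for s e c n :: complex
      by (simp add: divide_inverse algebra_simps)
    then show ?thesis unfolding P_integrand_def cot_def .
  qed
  ultimately show ?thesis
    using c0 by (simp add: mult_ac)
qed

section \<open>Location of the poles and their winding numbers\<close>

lemma sin_half_eq_0E:
  fixes t :: complex
  assumes "sin (t / 2) = 0"
  obtains m :: int where "t = of_real (2 * of_int m * pi)"
proof -
  from assms obtain m :: int where "t / 2 = of_real (of_int m * pi)"
    unfolding sin_eq_0 by blast
  then have "t = of_real (2 * of_int m * pi)" by (simp add: field_simps)
  then show thesis by (rule that)
qed

text \<open>A point with positive barycentric coordinates is interior, and the vertices are run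
  through counterclockwise: from 0 to the lower right, then up, then back.\<close>

lemma winding_number_isosceles_triangle:
  assumes "0 < p" "p < x" "0 < y"
  shows "winding_number (linepath 0 (Complex x (- y)) +++ linepath (Complex x (- y)) (Complex x y) +++
           linepath (Complex x y) 0) (of_real p) = 1"
proof -
  let ?b = "Complex x (- y)" and ?c = "Complex x y"
  have ncol: "\<not> collinear {0, ?b, ?c}"
    unfolding collinear_lemma using assms by (auto simp: complex_eq_iff)
  \<comment> \<open>Equal weights on the two right-hand vertices cancel the imaginary parts;
    together they contribute \<open>p / x\<close> times the abscissa \<open>x\<close>.\<close>
  have "(1 - p / x) *\<^sub>R 0 + (p / (2 * x)) *\<^sub>R ?b + (p / (2 * x)) *\<^sub>R ?c = of_real p"
    using assms by (simp add: complex_eq_iff)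
  moreover have "(1 - p / x) + p / (2 * x) + p / (2 * x) = 1" "0 < 1 - p / x" "0 < p / (2 * x)"
    using assms by auto
  ultimately have "of_real p \<in> interior (convex hull {0, ?b, ?c})"
    unfolding interior_convex_hull_3_minimal[OF ncol DIM_complex] mem_Collect_eq
    by (intro exI[of _ "1 - p / x"] exI[of _ "p / (2 * x)"] conjI)
  from winding_number_triangle[OF this] show ?thesis
    using assms by simp
qed

section \<open>The wedge and the holomorphic extension of the integrand\<close>

text \<open>\<open>K\<close> is the slope of a wedge around the positive axis, and \<open>a\<close>
  moves its vertex left of 0. The bound \<open>a < 2 * pi\<close> keeps the pole at -2 pi out;
  \<open>slope\<close> and the bound on \<open>3 * a\<close> keep out the points 2 pi m \<tau> with
  m nonzero, where \<open>exp (\<i> * t / \<tau>) = 1\<close>. Finally \<open>gap\<close> leaves a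
  decay rate \<open>\<delta>\<close> after paying for the opening of the wedge.\<close>

locale P_wedge =
  fixes \<tau> \<xi> :: complex and K a \<delta> :: real
  assumes tau: "0 < Im \<tau>"
    and K: "0 < K" "K \<le> 1"
    and a: "0 < a" "a < 2 * pi" "3 * a < 2 * pi * norm \<tau>"
    and delta: "0 < \<delta>"
    and slope: "2 * K * \<bar>Re (1 / \<tau>)\<bar> \<le> - Im (1 / \<tau>)"
    and gap: "\<delta> + K * (\<bar>Re (1 / \<tau>)\<bar> + \<bar>Re (\<xi> / \<tau>)\<bar>) \<le> - Im (1 / \<tau>) - \<bar>Im (\<xi> / \<tau>)\<bar>"
begin

text \<open>The vertex is \<open>- a\<close> rather than 0, so that 0 is an interior point and the
  triangle with vertex 0 lies in an open set.\<close>

definition W :: "complex set" where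
  "W = {t. \<bar>Im t\<bar> < K * (Re t + a)}"

text \<open>
  The zeros of \<open>sin (t / 2)\<close> have modulus at least \<open>2 \<pi>\<close> except for 0, so the second alternative only
  puts 0 back; stating it with a norm makes openness immediate.
\<close>

definition D :: "complex set" where
  "D = {t \<in> W. sin (t / 2) \<noteq> 0 \<or> norm t < 1}"

lemma tau_nz: "\<tau> \<noteq> 0"
  using tau by auto

lemma open_W: "open W"
  unfolding W_def by (intro open_Collect_less continuous_intros)

text \<open>Convexity later supplies both the connectedness and the vanishing of outside winding
  numbers that the residue theorem asks for.\<close>

lemma convex_W: "convex W"
proof -
  have "W = {t. Im t < K * (Re t + a)} \<inter> {t. - Im t < K * (Re t + a)}"
    by (auto simp: W_def abs_less_iff)
  also have "\<dots> = {t. Complex (- K) 1 \<bullet> t < K * a} \<inter> {t. Complex (- K) (- 1) \<bullet> t < K * a}"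
    by (auto simp: inner_complex_def algebra_simps)
  finally show ?thesis
    by (simp add: convex_Int convex_halfspace_lt)
qed

lemma open_D: "open D"
proof -
  have "D = W \<inter> ({t. sin (t / 2) \<noteq> 0} \<union> ball 0 1)"
    by (auto simp: D_def)
  moreover have "open {t::complex. sin (t / 2) \<noteq> 0}"
    by (intro open_Collect_neq continuous_intros) auto
  ultimately show ?thesis
    using open_W by auto
qed

lemma zero_in_D: "0 \<in> D"
  using K a by (auto simp: D_def W_def)

lemma sin_half_nonzero:
  assumes "t \<in> D" "t \<noteq> 0"
  shows "sin (t / 2) \<noteq> 0"
proof
  assume s: "sin (t / 2) = 0"
  then have n: "norm t < 1" using assms by (auto simp: D_def)
  from s obtain m where m: "t = of_real (2 * of_int m * pi)" by (rule sin_half_eq_0E)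
  with assms have "m \<noteq> 0" by auto
  then have "1 \<le> \<bar>real_of_int m\<bar>" by linarith
  then have "2 * 1 * pi \<le> 2 * \<bar>real_of_int m\<bar> * pi" by simp
  also have "\<dots> = norm t" unfolding m norm_of_real by (simp add: abs_mult)
  finally show False using n pi_gt3 by linarith
qed

text \<open>A solution is 2 pi m \<tau> with m nonzero, hence of modulus at least 2 pi |\<tau>|. On
  the other hand \<open>t / \<tau>\<close> is real, which ties \<open>Re t\<close> to
  \<open>Im t\<close>; inside the wedge \<open>slope\<close> then forces |Re t| <= \<open>a\<close>,
  so |Im t| < 2 \<open>a\<close> and |t| < 3 \<open>a\<close>, a contradiction.\<close>

lemma exp_ne_1:
  assumes "t \<in> W" "t \<noteq> 0"
  shows "exp (\<i> * t / \<tau>) \<noteq> 1"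
proof
  assume "exp (\<i> * t / \<tau>) = 1"
  then obtain m :: int where Re0: "Re (\<i> * t / \<tau>) = 0" and "Im (\<i> * t / \<tau>) = of_int (2 * m) * pi"
    unfolding exp_eq_1 by blast
  then have "\<i> * t / \<tau> = \<i> * of_real (of_int (2 * m) * pi)"
    by (intro complex_eqI) auto
  then have t: "t = of_real (of_int (2 * m) * pi) * \<tau>"
    using tau_nz by (simp add: field_simps)
  have m: "m \<noteq> 0" using assms(2) t by auto
  have n: "2 * pi * norm \<tau> \<le> norm t"
  proof -
    have "1 \<le> \<bar>real_of_int m\<bar>" using m by linarith
    then have "1 * (2 * pi * norm \<tau>) \<le> \<bar>real_of_int m\<bar> * (2 * pi * norm \<tau>)"
      by (intro mult_right_mono) auto
    then show ?thesis unfolding t by (simp add: norm_mult)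
  qed
  define c where "c = - Im (1 / \<tau>)"
  have c0: "c > 0" using tau
    by (auto simp: c_def Im_divide sum_power2_gt_zero_iff intro!: divide_pos_pos)
  have "Im (t / \<tau>) = 0" using Re0 Re_i_times[of "t / \<tau>"] by simp
  moreover have "Im (t / \<tau>) = Im (t * (1 / \<tau>))" by simp
  ultimately have "c * Re t = Im t * Re (1 / \<tau>)"
    by (simp only: times_complex.simps c_def) (simp add: algebra_simps)
  then have "c * \<bar>Re t\<bar> = \<bar>Im t\<bar> * \<bar>Re (1 / \<tau>)\<bar>"
    using c0 by (metis abs_mult abs_of_pos)
  also have "\<dots> \<le> (K * (Re t + a)) * \<bar>Re (1 / \<tau>)\<bar>"
    using assms(1) by (intro mult_right_mono) (auto simp: W_def)
  also have "\<dots> = (K * \<bar>Re (1 / \<tau>)\<bar>) * (Re t + a)" by simp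
  also have "\<dots> \<le> (c / 2) * (Re t + a)"
  proof (rule mult_right_mono)
    have "0 < K * (Re t + a)" using assms(1) by (simp add: W_def)
    then show "0 \<le> Re t + a" using K by (simp add: zero_less_mult_iff)
  qed (use slope in \<open>simp add: c_def\<close>)
  finally have "c * (2 * \<bar>Re t\<bar>) \<le> c * (Re t + a)" by simp
  then have "2 * \<bar>Re t\<bar> \<le> Re t + a" using c0 by simp
  then have r: "\<bar>Re t\<bar> \<le> a" by linarith
  have "\<bar>Im t\<bar> < K * (Re t + a)" using assms(1) by (simp add: W_def)
  also have "\<dots> \<le> 1 * (Re t + a)" using K r by (intro mult_right_mono) auto
  also have "\<dots> \<le> 2 * a" using r by simp
  finally have "\<bar>Im t\<bar> < 2 * a" .
  then have "norm t < 3 * a" using cmod_le[of t] r by linarith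
  then show False using n a by linarith
qed

text \<open>Boundedness near 0 makes the singularity removable. \<open>P_integrand\<close> itself
  only has the default value 0 there, coming from division by 0.\<close>

lemma P_integrand_extension:
  obtains G where "G holomorphic_on D" "\<And>t. t \<in> D \<Longrightarrow> t \<noteq> 0 \<Longrightarrow> G t = P_integrand \<tau> \<xi> t"
proof -
  have "P_integrand \<tau> \<xi> holomorphic_on D - {0}"
    unfolding P_integrand_def cot_def
    using sin_half_nonzero exp_ne_1 tau_nz
    by (intro holomorphic_intros) (auto simp: D_def)
  moreover have "0 \<in> interior D"
    using open_D zero_in_D by (simp add: interior_open)
  ultimately have "\<exists>G. G holomorphic_on D \<and> (\<forall>t\<in>D - {0}. G t = P_integrand \<tau> \<xi> t)"
    using P_integrand_bounded_at_0[OF tau_nz] by (subst holomorphic_on_extend_bounded) auto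
  then show thesis using that by blast
qed

section \<open>Exponential decay in the wedge\<close>

text \<open>The two sides compare the exponents of numerator and denominator. In each, the cross
  term containing \<open>Im t\<close> costs at most \<open>K * Re t\<close> times the modulus of a
  real part; \<open>gap\<close> says that this still leaves \<open>\<delta> * Re t\<close>.\<close>

lemma exponent_gap:
  assumes "\<bar>Im t\<bar> \<le> K * Re t"
  shows "\<bar>Im (\<xi> / \<tau> * t)\<bar> + \<delta> * Re t \<le> - Im (t / \<tau>)"
proof -
  define A B where "A = \<bar>Im (\<xi> / \<tau> * t)\<bar>" and "B = - Im (t / \<tau>)"
  have "0 \<le> K * Re t" using assms by linarith
  then have re0: "0 \<le> Re t" using K by (simp add: zero_le_mult_iff)
  have "A \<le> \<bar>Im (\<xi> / \<tau>)\<bar> * Re t + \<bar>Re (\<xi> / \<tau>)\<bar> * \<bar>Im t\<bar>"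
    unfolding A_def times_complex.simps
    using abs_triangle_ineq[of "Re (\<xi> / \<tau>) * Im t" "Im (\<xi> / \<tau>) * Re t"] re0
    by (simp add: abs_mult)
  also have "\<dots> \<le> \<bar>Im (\<xi> / \<tau>)\<bar> * Re t + \<bar>Re (\<xi> / \<tau>)\<bar> * (K * Re t)"
    using assms re0 by (intro add_left_mono mult_left_mono) auto
  finally have A: "A \<le> (\<bar>Im (\<xi> / \<tau>)\<bar> + K * \<bar>Re (\<xi> / \<tau>)\<bar>) * Re t"
    by (simp add: algebra_simps)
  have "- Im (1 / \<tau>) * Re t - \<bar>Re (1 / \<tau>)\<bar> * (K * Re t) \<le> - Im (1 / \<tau>) * Re t - \<bar>Re (1 / \<tau>)\<bar> * \<bar>Im t\<bar>"
    using assms re0 by (intro diff_left_mono mult_left_mono) auto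
  also have "\<dots> \<le> - Im (1 / \<tau>) * Re t - Re (1 / \<tau>) * Im t"
    using abs_ge_self[of "Re (1 / \<tau>) * Im t"] by (simp add: abs_mult)
  also have "\<dots> = - Im (1 / \<tau> * t)"
    unfolding times_complex.simps by simp
  also have "1 / \<tau> * t = t / \<tau>" by simp
  finally have B: "(- Im (1 / \<tau>) - K * \<bar>Re (1 / \<tau>)\<bar>) * Re t \<le> B"
    by (simp add: algebra_simps B_def)
  have "\<delta> * Re t \<le> (- Im (1 / \<tau>) - K * \<bar>Re (1 / \<tau>)\<bar> - (\<bar>Im (\<xi> / \<tau>)\<bar> + K * \<bar>Re (\<xi> / \<tau>)\<bar>)) * Re t"
    using gap re0 by (intro mult_right_mono) (auto simp: algebra_simps)
  then show ?thesis
    using A B unfolding A_def[symmetric] B_def[symmetric] by (simp add: algebra_simps)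
qed

text \<open>The numerator is at most \<open>exp A\<close>. The denominator is at least
  \<open>exp B - 1\<close>, which exceeds a fixed multiple of \<open>exp B\<close> because
  \<open>Re t\<close> >= 1 forces \<open>B\<close> >= \<open>\<delta>\<close>. The cotangent is left
  in the bound since rays and vertical segments need different estimates for it.\<close>

lemma norm_P_integrand_le:
  assumes "\<bar>Im t\<bar> \<le> K * Re t" "1 \<le> Re t"
  shows "norm (P_integrand \<tau> \<xi> t) \<le> exp (- \<delta> * Re t) / (1 - exp (- \<delta>)) * (norm (cot (t / 2)) + 2)"
proof -
  define A B where "A = \<bar>Im (\<xi> / \<tau> * t)\<bar>" and "B = - Im (t / \<tau>)"
  have AB: "A - B \<le> - \<delta> * Re t"
    using exponent_gap[OF assms(1)] by (simp add: A_def B_def)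
  have "A \<ge> 0" by (simp add: A_def)
  have "\<delta> * 1 \<le> \<delta> * Re t" using delta assms(2) by (intro mult_left_mono) auto
  then have "\<delta> \<le> B" using AB \<open>A \<ge> 0\<close> by linarith
  have e1: "1 - exp (- \<delta>) > 0" using delta by simp
  have "exp B * (1 - exp (- \<delta>)) \<le> exp B * (1 - exp (- B))"
    using \<open>\<delta> \<le> B\<close> by (intro mult_left_mono) auto
  also have "\<dots> = norm (exp (\<i> * t / \<tau>)) - norm (1::complex)"
    using Re_i_times[of "t / \<tau>"]
    by (simp add: B_def algebra_simps flip: exp_add)
  also have "\<dots> \<le> norm (exp (\<i> * t / \<tau>) - 1)" by (rule norm_triangle_ineq2)
  finally have den: "exp B * (1 - exp (- \<delta>)) \<le> norm (exp (\<i> * t / \<tau>) - 1)" .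
  have "norm (sin (\<xi> / \<tau> * t) / (exp (\<i> * t / \<tau>) - 1)) \<le> exp A / (exp B * (1 - exp (- \<delta>)))"
    unfolding norm_divide A_def
    by (intro frac_le norm_sin_le_exp_Im den) (use e1 in auto)
  also have "\<dots> = exp (A - B) / (1 - exp (- \<delta>))" by (simp add: exp_diff)
  also have "\<dots> \<le> exp (- \<delta> * Re t) / (1 - exp (- \<delta>))"
    using AB e1 by (intro divide_right_mono) auto
  finally have 1: "norm (sin (\<xi> / \<tau> * t) / (exp (\<i> * t / \<tau>) - 1)) \<le> exp (- \<delta> * Re t) / (1 - exp (- \<delta>))" .
  have t1: "1 \<le> norm t" using assms(2) complex_Re_le_cmod[of t] by linarith
  have "norm (cot (t / 2) - 2 / t) \<le> norm (cot (t / 2)) + norm (2 / t)" by (rule norm_triangle_ineq4)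
  also have "norm (2 / t) \<le> 2" using t1 by (simp add: norm_divide divide_le_eq)
  finally have 2: "norm (cot (t / 2) - 2 / t) \<le> norm (cot (t / 2)) + 2" by simp
  have "norm (P_integrand \<tau> \<xi> t) \<le> norm (sin (\<xi> / \<tau> * t) / (exp (\<i> * t / \<tau>) - 1) * (cot (t / 2) - 2 / t))"
    unfolding P_integrand_def norm_divide[of _ t] using t1
    by (simp add: divide_le_eq mult_le_cancel_left1)
  also have "\<dots> \<le> exp (- \<delta> * Re t) / (1 - exp (- \<delta>)) * (norm (cot (t / 2)) + 2)"
    unfolding norm_mult using 1 2 e1 by (intro mult_mono) auto
  finally show ?thesis .
qed

lemma ray_in_wedge:
  assumes "0 < d" "d < pi / 2" "tan d \<le> K" "\<phi> = d \<or> \<phi> = - d" "0 \<le> r"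
  shows "Re (of_real r * cis \<phi>) = r * cos d" "\<bar>Im (of_real r * cis \<phi>)\<bar> = r * sin d"
    "\<bar>Im (of_real r * cis \<phi>)\<bar> \<le> K * Re (of_real r * cis \<phi>)" "of_real r * cis \<phi> \<in> D"
proof -
  have cs: "cos d > 0" "sin d > 0"
    using assms by (auto intro!: cos_gt_zero sin_gt_zero)
  show re: "Re (of_real r * cis \<phi>) = r * cos d" and im: "\<bar>Im (of_real r * cis \<phi>)\<bar> = r * sin d"
    using assms cs by (auto simp: abs_mult)
  have "sin d \<le> K * cos d" using assms(3) cs by (simp add: tan_def divide_le_eq)
  then have "r * sin d \<le> r * (K * cos d)" using assms(5) by (rule mult_left_mono)
  then show le: "\<bar>Im (of_real r * cis \<phi>)\<bar> \<le> K * Re (of_real r * cis \<phi>)"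
    unfolding re im by (simp add: mult_ac)
  have "0 < K * a" using K a by simp
  then have W: "of_real r * cis \<phi> \<in> W" using le by (simp add: W_def distrib_left)
  show "of_real r * cis \<phi> \<in> D"
  proof (cases "r = 0")
    case False
    have "sin (of_real r * cis \<phi> / 2) \<noteq> 0"
    proof
      assume "sin (of_real r * cis \<phi> / 2) = 0"
      then obtain m where "of_real r * cis \<phi> = of_real (2 * of_int m * pi)"
        by (rule sin_half_eq_0E)
      then have "Im (of_real r * cis \<phi>) = 0" by (metis Im_complex_of_real)
      then show False using im False cs by simp
    qed
    then show ?thesis using W by (simp add: D_def)
  qed (use zero_in_D in simp)
qed

text \<open>Where \<open>Re t\<close> >= 1 the wedge estimate applies, and the cotangent is bounded
  because the ray stays at distance at least \<open>tan d\<close> from the real axis. The remaining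
  initial segment is compact. The rate is \<open>\<delta> * cos d\<close> since
  \<open>Re t = r * cos d\<close>.\<close>

lemma ray_decay:
  assumes G: "G holomorphic_on D" "\<And>t. t \<in> D \<Longrightarrow> t \<noteq> 0 \<Longrightarrow> G t = P_integrand \<tau> \<xi> t"
    and d: "0 < d" "d < pi / 2" "tan d \<le> K" "\<phi> = d \<or> \<phi> = - d"
  shows "continuous_on {0..} (\<lambda>r. G (of_real r * cis \<phi>))"
    and "\<exists>C. \<forall>r\<ge>0. norm (G (of_real r * cis \<phi>)) \<le> C * exp (- (\<delta> * cos d) * r)"
proof -
  note ray = ray_in_wedge[OF d]
  have cs: "cos d > 0" "sin d > 0"
    using d by (auto intro!: cos_gt_zero sin_gt_zero)
  have td: "tan d > 0" using cs by (simp add: tan_def)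
  show cont: "continuous_on {0..} (\<lambda>r. G (of_real r * cis \<phi>))"
    by (rule continuous_on_compose2[OF holomorphic_on_imp_continuous_on[OF G(1)]])
       (use ray(4) in \<open>auto intro!: continuous_intros\<close>)
  \<comment> \<open>The radius at which the ray reaches real part 1.\<close>
  define r0 where "r0 = 1 / cos d"
  have r0: "r0 > 0" using cs by (simp add: r0_def)
  have "compact ((\<lambda>r. G (of_real r * cis \<phi>)) ` {0..r0})"
    by (intro compact_continuous_image continuous_on_subset[OF cont]) auto
  then obtain M where M: "M > 0" "\<And>r. r \<in> {0..r0} \<Longrightarrow> norm (G (of_real r * cis \<phi>)) \<le> M"
    using compact_imp_bounded bounded_pos by (metis (no_types, lifting) imageI)
  define C1 where "C1 = (3 + 2 / tan d) / (1 - exp (- \<delta>))"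
  have e1: "1 - exp (- \<delta>) > 0" using delta by simp
  \<comment> \<open>On the initial segment the decay factor is at least
    \<open>exp (- \<delta>)\<close>; the factor \<open>exp \<delta>\<close> compensates for
    it.\<close>
  have "norm (G (of_real r * cis \<phi>)) \<le> max (M * exp \<delta>) C1 * exp (- (\<delta> * cos d) * r)"
    if "r \<ge> 0" for r
  proof (cases "r \<le> r0")
    case True
    then have "r * cos d \<le> 1" using cs by (simp add: r0_def field_simps)
    then have "\<delta> * (r * cos d) \<le> \<delta> * 1" using delta by (intro mult_left_mono) auto
    then have "1 \<le> exp \<delta> * exp (- (\<delta> * cos d) * r)"
      by (simp add: mult_ac flip: exp_add)
    then have "M * 1 \<le> M * (exp \<delta> * exp (- (\<delta> * cos d) * r))"
      using M(1) by (intro mult_left_mono) auto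
    also have "\<dots> \<le> max (M * exp \<delta>) C1 * exp (- (\<delta> * cos d) * r)"
      by (simp only: mult.assoc[symmetric]) (intro mult_right_mono, auto)
    finally show ?thesis using M(2)[of r] True that by auto
  next
    case False
    define t where "t = of_real r * cis \<phi>"
    have re: "Re t = r * cos d" and im: "\<bar>Im t\<bar> = r * sin d" and le: "\<bar>Im t\<bar> \<le> K * Re t" and D: "t \<in> D"
      using ray[OF that] by (auto simp: t_def)
    have re1: "1 \<le> Re t" using False cs by (simp add: re r0_def field_simps)
    then have "t \<noteq> 0" by auto
    have "1 * tan d \<le> Re t * tan d" using re1 td by (intro mult_right_mono) auto
    also have "Re t * tan d = \<bar>Im t\<bar>" using cs by (simp add: re im tan_def)
    finally have im1: "tan d \<le> \<bar>Im t\<bar>" by simp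
    have "norm (cot (t / 2)) \<le> 1 + 1 / \<bar>Im (t / 2)\<bar>"
      by (rule norm_cot_le) (use im1 td in auto)
    also have "\<dots> \<le> 1 + 2 / tan d"
      using im1 td by (simp add: frac_le)
    finally have cot: "norm (cot (t / 2)) + 2 \<le> 3 + 2 / tan d" by simp
    have "norm (G t) \<le> exp (- \<delta> * Re t) / (1 - exp (- \<delta>)) * (norm (cot (t / 2)) + 2)"
      using norm_P_integrand_le[OF le re1] G(2)[OF D \<open>t \<noteq> 0\<close>] by simp
    also have "\<dots> \<le> exp (- \<delta> * Re t) / (1 - exp (- \<delta>)) * (3 + 2 / tan d)"
      using cot e1 by (intro mult_left_mono) auto
    also have "\<dots> = C1 * exp (- (\<delta> * cos d) * r)" by (simp add: C1_def re mult_ac)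
    also have "\<dots> \<le> max (M * exp \<delta>) C1 * exp (- (\<delta> * cos d) * r)"
      by (intro mult_right_mono) auto
    finally show ?thesis by (simp add: t_def)
  qed
  then show "\<exists>C. \<forall>r\<ge>0. norm (G (of_real r * cis \<phi>)) \<le> C * exp (- (\<delta> * cos d) * r)" by blast
qed

lemma contour_integral_tendsto_P_ray:
  assumes G: "G holomorphic_on D" "\<And>t. t \<in> D \<Longrightarrow> t \<noteq> 0 \<Longrightarrow> G t = P_integrand \<tau> \<xi> t"
    and d: "0 < d" "d < pi / 2" "tan d \<le> K" "\<phi> = d \<or> \<phi> = - d"
  shows "((\<lambda>R. contour_integral (linepath 0 (of_real R * cis \<phi>)) G) \<longlongrightarrow> P_ray \<phi> \<tau> \<xi>) at_top"
proof -
  let ?h = "\<lambda>r. G (of_real r * cis \<phi>) * cis \<phi>"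
  have cd: "cos d > 0" using d by (auto intro!: cos_gt_zero)
  note cont = ray_decay(1)[OF G d]
  obtain C where C: "\<And>r. r \<ge> 0 \<Longrightarrow> norm (G (of_real r * cis \<phi>)) \<le> C * exp (- (\<delta> * cos d) * r)"
    using ray_decay(2)[OF G d] by blast
  have "((\<lambda>R. integral {0..R} ?h) \<longlongrightarrow> integral {0..} ?h) at_top"
  proof (rule integral_to_infinity_tendsto)
    show "continuous_on {0..} ?h" by (intro continuous_intros cont)
    show "0 < \<delta> * cos d" using delta cd by simp
    show "norm (?h r) \<le> C * exp (- (\<delta> * cos d) * r)" if "r \<ge> 0" for r
      using C[OF that] by (simp add: norm_mult)
  qed
  moreover have "integral {0..} ?h = P_ray \<phi> \<tau> \<xi>"
    unfolding P_ray_def ray_integral_def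
  \<comment> \<open>\<open>G\<close> and the integrand may differ only at the origin, a null
    set.\<close>
  proof (rule integral_spike[of "{0}"])
    fix r :: real assume r: "r \<in> {0..} - {0}"
    then have "G (of_real r * cis \<phi>) = P_integrand \<tau> \<xi> (of_real r * cis \<phi>)"
      using ray_in_wedge(4)[OF d, of r] by (intro G(2)) auto
    then show "sin (\<xi> / \<tau> * (of_real r * cis \<phi>)) / (exp (\<i> * (of_real r * cis \<phi>) / \<tau>) - 1) *
         (cot (of_real r * cis \<phi> / 2) - 2 / (of_real r * cis \<phi>)) / (of_real r * cis \<phi>) * cis \<phi> = ?h r"
      by (simp add: P_integrand_def)
  qed simp
  moreover have "eventually (\<lambda>R. integral {0..R} ?h = contour_integral (linepath 0 (of_real R * cis \<phi>)) G) at_top"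
    using eventually_gt_at_top[of 0]
    by eventually_elim (rule contour_integral_ray[symmetric], auto intro: continuous_on_subset[OF cont])
  ultimately show ?thesis
    using Lim_transform_eventually by fastforce
qed

section \<open>The residue theorem on a triangle\<close>

text \<open>The boundary of the triangle 0, \<open>b\<close>, \<open>c\<close> consists of the two
  truncated rays and a vertical side, whose integral is the whole error. The abscissa
  \<open>x\<close> is midway between the poles 2 pi N and 2 pi (N + 1), so the cotangent is at most
  1 there; the factor 3 is this 1 plus the 2 bounding \<open>2 / t\<close>, and
  \<open>2 * x * tan d\<close> is the length of the side.\<close>

lemma P_integrand_residue_sum:
  assumes G: "G holomorphic_on D" "\<And>t. t \<in> D \<Longrightarrow> t \<noteq> 0 \<Longrightarrow> G t = P_integrand \<tau> \<xi> t"
    and d: "0 < d" "d < pi / 2" "tan d \<le> K"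
    and x: "x = (2 * real N + 1) * pi"
  defines "b \<equiv> of_real (x / cos d) * cis (- d)" and "c \<equiv> of_real (x / cos d) * cis d"
    and "p \<equiv> \<lambda>n. of_real (2 * real (Suc n) * pi)"
  shows "norm (contour_integral (linepath 0 b) G - contour_integral (linepath 0 c) G -
      2 * of_real pi * \<i> * (\<Sum>n<N. 2 * (sin (\<xi> / \<tau> * p n) / ((exp (\<i> * p n / \<tau>) - 1) * p n))))
    \<le> 3 * exp (- \<delta> * x) / (1 - exp (- \<delta>)) * (2 * x * tan d)"
proof -
  have cs: "cos d > 0" "sin d > 0"
    using d by (auto intro!: cos_gt_zero sin_gt_zero)
  have td: "tan d > 0" using cs by (simp add: tan_def)
  have "pi * 1 \<le> pi * (2 * real N + 1)" by (intro mult_left_mono) auto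
  then have x_pi: "pi \<le> x" by (simp add: x mult_ac)
  then have x1: "1 \<le> x" using pi_gt3 by linarith
  have b: "b = Complex x (- (x * tan d))" and c: "c = Complex x (x * tan d)"
    using cs by (auto simp: b_def c_def complex_eq_iff tan_def)
  have seg: "closed_segment 0 (of_real r * cis \<phi>) \<subseteq> D \<inter> {t. Re t \<le> r * cos d}"
    if "\<phi> = d \<or> \<phi> = - d" "0 \<le> r" for \<phi> r
  proof
    fix t assume "t \<in> closed_segment 0 (of_real r * cis \<phi>)"
    then obtain u where u: "0 \<le> u" "u \<le> 1" "t = of_real (u * r) * cis \<phi>"
      by (auto simp: closed_segment_def scaleR_conv_of_real mult_ac)
    have ur: "0 \<le> u * r" "u * r \<le> r" using u that by (auto simp: mult_left_le_one_le)
    then have "u * r * cos d \<le> r * cos d" using cs by (intro mult_right_mono) auto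
    then show "t \<in> D \<inter> {t. Re t \<le> r * cos d}"
      using ray_in_wedge(1,4)[OF d that(1) ur(1)] unfolding u(3) by (metis IntI mem_Collect_eq)
  qed
  have seg_b: "closed_segment 0 b \<subseteq> D \<inter> {t. Re t \<le> x}" and seg_c: "closed_segment 0 c \<subseteq> D \<inter> {t. Re t \<le> x}"
    using seg[of "- d" "x / cos d"] seg[of d "x / cos d"] cs x1 by (auto simp: b_def c_def)
  have vert: "Re t = x \<and> \<bar>Im t\<bar> \<le> x * tan d" if "t \<in> closed_segment b c" for t
  proof -
    have "closed_segment b c \<subseteq> {t. Re t = x} \<inter> {t. \<bar>Im t\<bar> \<le> x * tan d}"
    proof (rule closed_segment_subset)
      have "{t. Re t = x} \<inter> {t. \<bar>Im t\<bar> \<le> x * tan d} =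
          {t. Re t \<le> x} \<inter> {t. Re t \<ge> x} \<inter> {t. Im t \<le> x * tan d} \<inter> {t. Im t \<ge> - (x * tan d)}"
        by auto
      then show "convex ({t. Re t = x} \<inter> {t. \<bar>Im t\<bar> \<le> x * tan d})"
        by (simp only:) (intro convex_Int convex_halfspace_Re_le convex_halfspace_Re_ge
          convex_halfspace_Im_le convex_halfspace_Im_ge)
    qed (use x1 td in \<open>auto simp: b c\<close>)
    then show ?thesis using that by auto
  qed
  have vert_le: "\<bar>Im t\<bar> \<le> K * Re t" if "t \<in> closed_segment b c" for t
  proof -
    have "x * tan d \<le> x * K" using d x1 by (intro mult_left_mono) auto
    then show ?thesis using vert[OF that] by (simp add: mult_ac)
  qed
  \<comment> \<open>\<open>x / 2\<close> is an odd multiple of \<open>pi / 2\<close>.\<close>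
  have cos0: "cos (x / 2) = 0"
    unfolding cos_zero_iff_int by (intro exI[of _ "2 * int N + 1"]) (simp add: x)
  have vert_sin: "sin (t / 2) \<noteq> 0" if "t \<in> closed_segment b c" for t
  proof
    assume "sin (t / 2) = 0"
    then have "sin (x / 2) ^ 2 + (exp (Im t / 2) - inverse (exp (Im t / 2))) ^ 2 / 4 = 0"
      using norm_sin_squared'[of "t / 2"] vert[OF that] by simp
    moreover have "sin (x / 2) ^ 2 = 1" using cos0 sin_cos_squared_add[of "x / 2"] by simp
    ultimately show False
      using zero_le_power2[of "exp (Im t / 2) - inverse (exp (Im t / 2))"] by linarith
  qed
  have vert_D: "closed_segment b c \<subseteq> D \<inter> {t. Re t \<le> x}"
  proof
    fix t assume t: "t \<in> closed_segment b c"
    have "0 < K * a" using K a by simp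
    then show "t \<in> D \<inter> {t. Re t \<le> x}"
      using vert[OF t] vert_le[OF t] vert_sin[OF t] by (simp add: D_def W_def distrib_left)
  qed
  have int: "G contour_integrable_on linepath u v" if "closed_segment u v \<subseteq> D" for u v
    by (intro contour_integrable_continuous_linepath continuous_on_subset[OF _ that]
        holomorphic_on_imp_continuous_on G)
  let ?g = "linepath 0 b +++ linepath b c +++ linepath c 0"
  have img: "path_image ?g \<subseteq> D \<inter> {t. Re t \<le> x}"
    using seg_b seg_c vert_D by (simp add: path_image_join closed_segment_commute)
  have split: "contour_integral ?g G =
      contour_integral (linepath 0 b) G + contour_integral (linepath b c) G - contour_integral (linepath 0 c) G"
    using int[of 0 b] int[of b c] int[of c 0] seg_b seg_c vert_D
      contour_integral_reversepath[of "linepath 0 c" G]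
    by (auto simp: closed_segment_commute)
  define pts where "pts = p ` {..<N}"
  \<comment> \<open>Cutting the wedge just before the pole 2 pi (N + 1) leaves only the
    \<open>N\<close> poles in \<open>pts\<close>, while the triangle still fits inside.\<close>
  define S where "S = W \<inter> {t. Re t < 2 * pi * (real N + 1)}"
  have S: "open S" "convex S"
    unfolding S_def using open_W convex_W
    by (auto intro!: open_Int convex_Int convex_halfspace_Re_lt open_halfspace_Re_lt)
  have pole_notin_D: "p n \<notin> D" for n
  proof
    assume "p n \<in> D"
    moreover have "p n \<noteq> 0" by (simp add: p_def del: of_nat_Suc)
    moreover have "sin (p n / 2) = 0"
      unfolding sin_eq_0 by (intro exI[of _ "int (Suc n)"]) (simp add: p_def)
    ultimately show False using sin_half_nonzero by blast
  qed
  \<comment> \<open>For a zero 2 pi m of \<open>sin (t / 2)\<close> in \<open>S\<close>, the vertex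
    \<open>- a\<close> excludes m < 0 and the right cut excludes m > \<open>N\<close>. The value m =
    0 belongs to \<open>D\<close>, and m >= 1 is \<open>p\<close> at index m - 1.\<close>
  have S_pts: "S - pts \<subseteq> D"
  proof
    fix t assume t: "t \<in> S - pts"
    show "t \<in> D"
    proof (cases "sin (t / 2) = 0")
      case True
      then obtain m where m: "t = of_real (2 * of_int m * pi)" by (rule sin_half_eq_0E)
      have "0 < K * (Re t + a)" using t by (auto simp: S_def W_def)
      then have "- a < Re t" using K by (simp add: zero_less_mult_iff)
      then have "- (2 * pi) < 2 * pi * of_int m" using a by (simp add: m mult_ac)
      then have "2 * pi * (- 1) < 2 * pi * of_int m" by simp
      then have m0: "m \<ge> 0" by (subst (asm) mult_less_cancel_left_pos) auto
      have "2 * pi * of_int m < 2 * pi * (real N + 1)" using t by (auto simp: S_def m mult_ac)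
      then have "of_int m < real N + 1" by (subst (asm) mult_less_cancel_left_pos) auto
      then have mN: "m \<le> int N" by linarith
      have "m = 0"
      proof (rule ccontr)
        assume "m \<noteq> 0"
        then have "t = p (nat (m - 1))" "nat (m - 1) < N"
          using m0 mN by (auto simp: p_def m)
        then show False using t by (auto simp: pts_def)
      qed
      then show ?thesis using m zero_in_D by simp
    next
      case False
      then show ?thesis using t by (auto simp: S_def D_def)
    qed
  qed
  have x_less: "x < 2 * pi * (real N + 1)" by (simp add: x algebra_simps)
  have img_S: "path_image ?g \<subseteq> S - pts"
    using img x_less pole_notin_D by (fastforce simp: S_def pts_def D_def)
  have "contour_integral ?g G = 2 * pi * \<i> * (\<Sum>q\<in>pts. winding_number ?g q * residue G q)"
  proof (rule Residue_theorem)
    show "open S" "connected S" using S convex_connected by auto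
    show "finite pts" by (simp add: pts_def)
    show "G holomorphic_on S - pts" by (rule holomorphic_on_subset[OF G(1) S_pts])
    show "path_image ?g \<subseteq> S - pts" by (rule img_S)
    show "\<forall>z. z \<notin> S \<longrightarrow> winding_number ?g z = 0"
      using img_S S(2) by (intro allI impI winding_number_zero_outside[of _ S]) auto
  qed auto
  also have "(\<Sum>q\<in>pts. winding_number ?g q * residue G q) = (\<Sum>n<N. winding_number ?g (p n) * residue G (p n))"
    unfolding pts_def by (subst sum.reindex) (auto simp: inj_on_def p_def)
  also have "\<dots> = (\<Sum>n<N. 2 * (sin (\<xi> / \<tau> * p n) / ((exp (\<i> * p n / \<tau>) - 1) * p n)))"
  proof (rule sum.cong)
    fix n assume n: "n \<in> {..<N}"
    have "2 * real (Suc n) * pi < x"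
      unfolding x using n by (intro mult_strict_right_mono) auto
    then have wn: "winding_number ?g (p n) = 1"
      unfolding b c p_def using x1 td by (intro winding_number_isosceles_triangle) auto
    have pS: "p n \<in> S"
    proof -
      have "0 < K * (2 * real (Suc n) * pi + a)" using K a by (intro mult_pos_pos add_pos_pos) auto
      moreover have "2 * real (Suc n) * pi < 2 * pi * (real N + 1)"
        using \<open>_ < x\<close> x_less by linarith
      ultimately show ?thesis by (simp add: S_def W_def p_def)
    qed
    have "residue G (p n) = 2 * (sin (\<xi> / \<tau> * p n) / ((exp (\<i> * p n / \<tau>) - 1) * p n))"
    proof (rule residue_simple')
      \<comment> \<open>An open neighbourhood of \<open>p n\<close> containing none of the other
        poles.\<close>
      let ?T = "S - (pts - {p n})"
      have eq: "?T - {p n} \<subseteq> S - pts" by auto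
      show T: "open ?T" using S by (intro open_Diff finite_imp_closed) (auto simp: pts_def)
      show pT: "p n \<in> ?T" using pS by auto
      show "G holomorphic_on ?T - {p n}"
        using holomorphic_on_subset[OF G(1)] S_pts eq by blast
      have pnz: "p n \<noteq> 0" by (simp add: p_def del: of_nat_Suc)
      have "exp (\<i> * p n / \<tau>) \<noteq> 1"
        using pS pnz by (intro exp_ne_1) (auto simp: S_def)
      then have "((\<lambda>w. P_integrand \<tau> \<xi> w * (w - p n)) \<longlongrightarrow>
           2 * (sin (\<xi> / \<tau> * p n) / ((exp (\<i> * p n / \<tau>) - 1) * p n))) (at (p n))"
        using tau_nz by (intro P_integrand_residue_limit[of _ _ "Suc n"]) (auto simp: p_def)
      moreover have "eventually (\<lambda>w. w \<in> ?T - {p n}) (at (p n))"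
        using T pT by (rule eventually_at_in_open)
      moreover have "eventually (\<lambda>w. w \<noteq> 0) (at (p n))"
        using pnz by (intro tendsto_imp_eventually_ne[OF tendsto_ident_at]) auto
      \<comment> \<open>The limit is known for \<open>P_integrand\<close>, which agrees with
        \<open>G\<close> near \<open>p n\<close>.\<close>
      ultimately show "((\<lambda>w. G w * (w - p n)) \<longlongrightarrow>
           2 * (sin (\<xi> / \<tau> * p n) / ((exp (\<i> * p n / \<tau>) - 1) * p n))) (at (p n))"
      proof (elim Lim_transform_eventually)
        assume "eventually (\<lambda>w. w \<in> ?T - {p n}) (at (p n))" "eventually (\<lambda>w. w \<noteq> 0) (at (p n))"
        then show "eventually (\<lambda>w. P_integrand \<tau> \<xi> w * (w - p n) = G w * (w - p n)) (at (p n))"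
        proof eventually_elim
          case (elim w)
          then have "w \<in> D" using S_pts eq by blast
          then show ?case using elim by (simp add: G(2))
        qed
      qed
    qed
    then show "winding_number ?g (p n) * residue G (p n) =
        2 * (sin (\<xi> / \<tau> * p n) / ((exp (\<i> * p n / \<tau>) - 1) * p n))"
      using wn by simp
  qed simp
  finally have eq: "contour_integral (linepath 0 b) G + contour_integral (linepath b c) G - contour_integral (linepath 0 c) G =
      2 * of_real pi * \<i> * (\<Sum>n<N. 2 * (sin (\<xi> / \<tau> * p n) / ((exp (\<i> * p n / \<tau>) - 1) * p n)))"
    unfolding split by simp
  have total: "contour_integral (linepath 0 b) G - contour_integral (linepath 0 c) G -
      2 * of_real pi * \<i> * (\<Sum>n<N. 2 * (sin (\<xi> / \<tau> * p n) / ((exp (\<i> * p n / \<tau>) - 1) * p n))) =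
      - contour_integral (linepath b c) G"
    unfolding eq[symmetric] by simp
  have e1: "1 - exp (- \<delta>) > 0" using delta by simp
  have "norm (contour_integral (linepath b c) G) \<le> 3 * exp (- \<delta> * x) / (1 - exp (- \<delta>)) * norm (c - b)"
  proof (rule contour_integral_bound_linepath)
    show "G contour_integrable_on linepath b c" using vert_D by (intro int) auto
    fix t assume t: "t \<in> closed_segment b c"
    have re: "Re t = x" using vert[OF t] by auto
    then have "t \<noteq> 0" using x1 by auto
    have "norm (G t) \<le> exp (- \<delta> * Re t) / (1 - exp (- \<delta>)) * (norm (cot (t / 2)) + 2)"
      using norm_P_integrand_le[OF vert_le[OF t]] re x1 G(2)[OF _ \<open>t \<noteq> 0\<close>] vert_D t by auto
    also have "\<dots> \<le> exp (- \<delta> * x) / (1 - exp (- \<delta>)) * 3"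
      unfolding re using e1 norm_cot_le_1[of "t / 2"] cos0 re by (intro mult_left_mono) auto
    finally show "norm (G t) \<le> 3 * exp (- \<delta> * x) / (1 - exp (- \<delta>))" by (simp add: mult_ac)
  qed (use e1 in auto)
  also have "norm (c - b) = 2 * x * tan d"
  proof -
    have "c - b = \<i> * of_real (2 * x * tan d)" by (simp add: b c complex_eq_iff)
    then show ?thesis using x1 td by (simp add: norm_mult del: of_real_mult)
  qed
  finally show ?thesis unfolding total by simp
qed

section \<open>Passage to the limit and the conclusion\<close>

text \<open>As the vertical side moves to infinity, the truncated rays converge and the error, of
  order x exp(- \<delta> x), vanishes. The partial sums therefore converge, so summability comes
  along with the value.\<close>

lemma P_ray_difference_sums:
  assumes d: "0 < d" "d < pi / 2" "tan d \<le> K"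
  shows "(\<lambda>n. 2 * \<i> * (sin (2 * of_nat (Suc n) * \<xi> * of_real pi / \<tau>) /
             (of_nat (Suc n) * (exp (2 * of_nat (Suc n) * of_real pi * \<i> / \<tau>) - 1))))
         sums (P_ray (- d) \<tau> \<xi> - P_ray d \<tau> \<xi>)" (is "?f sums ?L")
proof -
  obtain G where G: "G holomorphic_on D" "\<And>t. t \<in> D \<Longrightarrow> t \<noteq> 0 \<Longrightarrow> G t = P_integrand \<tau> \<xi> t"
    using P_integrand_extension by blast
  have cd: "cos d > 0" using d by (auto intro!: cos_gt_zero)
  define X where "X = (\<lambda>N. (2 * real N + 1) * pi)"
  define p where "p = (\<lambda>n. complex_of_real (2 * real (Suc n) * pi))"
  \<comment> \<open>Truncating at radius \<open>X N / cos d\<close> puts the end point on the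
    vertical line with abscissa \<open>X N\<close>.\<close>
  define I where "I = (\<lambda>\<phi> N. contour_integral (linepath 0 (of_real (X N / cos d) * cis \<phi>)) G)"
  \<comment> \<open>The factor 2 pi i of the residue theorem times 2 / (2 (n + 1) pi) is 2 i / (n +
    1).\<close>
  have f_eq: "2 * of_real pi * \<i> * (2 * (sin (\<xi> / \<tau> * p n) / ((exp (\<i> * p n / \<tau>) - 1) * p n))) = ?f n" for n
  proof -
    have "\<xi> / \<tau> * p n = 2 * of_nat (Suc n) * \<xi> * of_real pi / \<tau>"
         "\<i> * p n / \<tau> = 2 * of_nat (Suc n) * of_real pi * \<i> / \<tau>"
      by (simp_all add: p_def mult_ac)
    moreover have "2 * of_real pi * \<i> * (2 * (s / (e * p n))) = 2 * \<i> * (s / (of_nat (Suc n) * e))" for s e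
      by (simp add: p_def divide_simps del: of_nat_Suc)
    ultimately show ?thesis by (simp only:)
  qed
  have X_top: "filterlim X at_top sequentially"
    unfolding X_def by real_asymp
  have R_top: "filterlim (\<lambda>N. X N / cos d) at_top sequentially"
    unfolding X_def using cd by real_asymp
  have I_lim: "I \<phi> \<longlonglongrightarrow> P_ray \<phi> \<tau> \<xi>" if "\<phi> = d \<or> \<phi> = - d" for \<phi>
    using filterlim_compose[OF contour_integral_tendsto_P_ray[OF G d that] R_top]
    unfolding I_def by simp
  have "(\<lambda>N. I (- d) N - I d N - (\<Sum>n<N. ?f n)) \<longlonglongrightarrow> 0"
  proof (rule tendsto_norm_zero_cancel, rule tendsto_sandwich[OF _ _ tendsto_const])
    have "((\<lambda>x. 3 * exp (- \<delta> * x) / (1 - exp (- \<delta>)) * (2 * x * tan d)) \<longlongrightarrow> 0) at_top"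
      using delta by real_asymp
    from filterlim_compose[OF this X_top]
    show "(\<lambda>N. 3 * exp (- \<delta> * X N) / (1 - exp (- \<delta>)) * (2 * X N * tan d)) \<longlonglongrightarrow> 0" .
    show "eventually (\<lambda>N. norm (I (- d) N - I d N - (\<Sum>n<N. ?f n)) \<le>
        3 * exp (- \<delta> * X N) / (1 - exp (- \<delta>)) * (2 * X N * tan d)) sequentially"
    proof (rule always_eventually, rule allI)
      fix N
      show "norm (I (- d) N - I d N - (\<Sum>n<N. ?f n)) \<le>
        3 * exp (- \<delta> * X N) / (1 - exp (- \<delta>)) * (2 * X N * tan d)"
        using P_integrand_residue_sum[OF G d, of "X N" N]
        unfolding I_def X_def f_eq[symmetric] p_def sum_distrib_left by simp
    qed
  qed auto
  from tendsto_diff[OF tendsto_diff[OF I_lim[of "- d"] I_lim[of d]] this]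
  show ?thesis by (simp add: sums_def)
qed

text \<open>With \<sigma> = \<open>Arg \<tau> - \<phi>\<close> one has
  \<open>cis \<phi> / \<tau>\<close> = cis(- \<sigma>) / |\<tau>|, so \<open>exponent_gap\<close> at
  the point \<open>cis \<phi>\<close>, multiplied by |\<tau>|, is the strip condition defining
  \<open>Omega \<phi>\<close>.\<close>

lemma in_Omega:
  assumes "\<bar>\<phi>\<bar> < pi / 2" "\<bar>sin \<phi>\<bar> \<le> K * cos \<phi>" "0 < Arg \<tau> - \<phi>" "Arg \<tau> - \<phi> < pi"
  shows "(\<tau>, \<xi>) \<in> Omega \<phi>"
proof -
  have n: "norm \<tau> > 0" using tau_nz by simp
  have tau_eq: "\<tau> = of_real (norm \<tau>) * cis (\<phi> + (Arg \<tau> - \<phi>))"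
    using rcis_cmod_Arg[of \<tau>] by (simp add: rcis_def)
  have inv: "cis \<phi> / \<tau> = cis (- (Arg \<tau> - \<phi>)) / of_real (norm \<tau>)"
    using n by (subst tau_eq) (simp add: field_simps flip: cis_divide)
  have "cos \<phi> > 0" using assms(1) by (intro cos_gt_zero_pi) auto
  then have "0 < \<delta> * Re (cis \<phi>)" using delta by simp
  moreover have "\<bar>Im (cis \<phi>)\<bar> \<le> K * Re (cis \<phi>)" using assms(2) by simp
  ultimately have "\<bar>Im (\<xi> / \<tau> * cis \<phi>)\<bar> < - Im (cis \<phi> / \<tau>)"
    using exponent_gap[of "cis \<phi>"] by linarith
  moreover have "\<xi> / \<tau> * cis \<phi> = \<xi> * cis (- (Arg \<tau> - \<phi>)) / of_real (norm \<tau>)"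
    using inv by (metis times_divide_eq_left times_divide_eq_right)
  ultimately have "\<bar>Im (\<xi> * cis (- (Arg \<tau> - \<phi>)))\<bar> < sin (Arg \<tau> - \<phi>)"
    unfolding inv using n by (simp add: abs_divide divide_strict_right_mono field_simps del: minus_diff_eq)
  then show ?thesis
    unfolding Omega_def using tau_eq n assms(3,4) by blast
qed

end

theorem theorem5:
  fixes P_minus P_plus :: "complex \<times> complex \<Rightarrow> complex" and \<tau> \<xi> :: complex
  assumes "is_P_minus P_minus" and "is_P_plus P_plus"
    and "0 < Im \<tau>" and "\<bar>Im (\<xi> / \<tau>)\<bar> < - Im (1 / \<tau>)"
  shows "summable (\<lambda>n. sin (2 * of_nat (Suc n) * \<xi> * of_real pi / \<tau>) /
             (of_nat (Suc n) * (exp (2 * of_nat (Suc n) * of_real pi * \<i> / \<tau>) - 1))) \<and>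
         P_minus (\<tau>, \<xi>) - P_plus (\<tau>, \<xi>) =
           2 * \<i> * (\<Sum>n. sin (2 * of_nat (Suc n) * \<xi> * of_real pi / \<tau>) /
             (of_nat (Suc n) * (exp (2 * of_nat (Suc n) * of_real pi * \<i> / \<tau>) - 1)))"
proof -
  \<comment> \<open>Half of \<open>gp\<close> becomes the decay rate and the other half pays for
    \<open>K * B\<close>. The denominator \<open>B + 1\<close> stays positive even if
    \<open>B\<close> is 0.\<close>
  define gp where "gp = - Im (1 / \<tau>) - \<bar>Im (\<xi> / \<tau>)\<bar>"
  define B where "B = \<bar>Re (1 / \<tau>)\<bar> + \<bar>Re (\<xi> / \<tau>)\<bar>"
  define K where "K = min 1 (gp / (2 * (B + 1)))"
  \<comment> \<open>\<open>a\<close> <= 1 gives \<open>a < 2 * pi\<close>, and \<open>a\<close> <=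
    |\<tau>| gives \<open>3 * a < 2 * pi * norm \<tau>\<close> because pi > 3.\<close>
  define a where "a = min 1 (norm \<tau>)"
  have gp: "gp > 0" using assms(4) by (simp add: gp_def)
  have B: "B \<ge> 0" by (simp add: B_def)
  have K: "0 < K" "K \<le> 1" using gp B by (auto simp: K_def)
  have n: "norm \<tau> > 0" using assms(3) by auto
  have KB: "K * B \<le> gp / 2"
  proof -
    have "K * B \<le> K * (B + 1)" using K by simp
    also have "\<dots> \<le> gp / (2 * (B + 1)) * (B + 1)"
      using B by (intro mult_right_mono) (auto simp: K_def)
    also have "\<dots> = gp / 2" using B by (simp add: field_simps)
    finally show ?thesis .
  qed
  interpret P_wedge \<tau> \<xi> K a "gp / 2"
  proof
    show "0 < a" "a < 2 * pi" using n pi_gt3 by (auto simp: a_def)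
    have "3 * a \<le> 3 * norm \<tau>" by (simp add: a_def)
    also have "\<dots> < 2 * pi * norm \<tau>" using n pi_gt3 by simp
    finally show "3 * a < 2 * pi * norm \<tau>" .
    have "K * \<bar>Re (1 / \<tau>)\<bar> \<le> K * B" using K by (intro mult_left_mono) (auto simp: B_def)
    then show "2 * K * \<bar>Re (1 / \<tau>)\<bar> \<le> - Im (1 / \<tau>)"
      using KB unfolding gp_def by simp
    have "gp / 2 + K * B \<le> gp" using KB by simp
    then show "gp / 2 + K * (\<bar>Re (1 / \<tau>)\<bar> + \<bar>Re (\<xi> / \<tau>)\<bar>) \<le> - Im (1 / \<tau>) - \<bar>Im (\<xi> / \<tau>)\<bar>"
      unfolding B_def gp_def .
  qed (use assms K gp in auto)
  have Arg: "0 < Arg \<tau>" "Arg \<tau> < pi"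
    using Arg_lt_pi[of \<tau>] assms(3) by auto
  \<comment> \<open>\<open>arctan K\<close> keeps both rays in the wedge. The other two bounds put
    \<open>Arg \<tau> - d\<close> and \<open>Arg \<tau> + d\<close> into (0, pi), so that the point
    lies in \<open>Omega d\<close> and in \<open>Omega (- d)\<close>.\<close>
  define d where "d = min (arctan K) (min (Arg \<tau> / 2) ((pi - Arg \<tau>) / 2))"
  have d0: "0 < d" and d_le: "d \<le> arctan K" "d < Arg \<tau>" "d < pi - Arg \<tau>"
    using K Arg by (auto simp: d_def min_def)
  have d2: "d < pi / 2" using d_le(1) arctan_ubound[of K] by linarith
  have "tan d \<le> tan (arctan K)"
    using d0 d_le(1) arctan_ubound[of K] by (subst tan_mono_le_eq) auto
  then have td: "tan d \<le> K" by (simp add: tan_arctan)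
  have cs: "cos d > 0" "sin d > 0"
    using d0 d2 by (auto intro!: cos_gt_zero sin_gt_zero)
  have sd: "\<bar>sin d\<bar> \<le> K * cos d"
    using td cs by (simp add: tan_def divide_le_eq)
  have "P_minus (\<tau>, \<xi>) = P_ray (- d) \<tau> \<xi>"
    using assms(1) in_Omega[of "- d"] d0 d2 d_le sd unfolding is_P_minus_def by fastforce
  moreover have "P_plus (\<tau>, \<xi>) = P_ray d \<tau> \<xi>"
    using assms(2) in_Omega[of d] d0 d2 d_le sd Arg unfolding is_P_plus_def by fastforce
  moreover note sums_mult_D[OF P_ray_difference_sums[OF d0 d2 td]]
  ultimately show ?thesis
    by (simp add: sums_iff)
qed

end
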